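(* Let $G=(V,E)$ be a complete directed graph with $n=|V|$ vertices and weights $w\in\mathbb{R}^E_{\ge0}$, and let $\varepsilon\ge0$. Put $c_e=\min\{\varepsilon,w_e\}$ for $e\in E$, $C=\sum_{e\in E}c_e$, and, for each edge $e=(i,u)\in E$, $$w^{\mathrm{wc}}_e=w_e+\min\Bigl\{\varepsilon,\ \sum_{e'\in E_{\mathrm{in}}(u)\setminus\{e\}}\min\{\varepsilon,w_{e'}\}\Bigr\}.$$ Then $$\mathrm{OPT}(w^{\mathrm{wc}})\ \le\ \mathrm{OPT}_{\mathrm{RTSP}}\bigl(w,\mathcal D^{\mathrm{L},\infty}(\varepsilon)\bigr)\ \le\ \min\bigl\{\mathrm{OPT}(w)+n\varepsilon,\ C+\mathrm{OPT}(w-c)\bigr\}.$$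
   Context: Complete directed graph: one edge for each ordered pair of distinct vertices. $\mathcal H$ is the set of Hamiltonian cycles of $G$ (directed cycles visiting every vertex exactly once), identified with their edge sets. $E_{\mathrm{in}}(u)$ and $E_{\mathrm{out}}(u)$ are the edges entering/leaving $u$. $\mathcal D^{\mathrm{L},\infty}(\varepsilon)$ is the set of $(\Delta^+,\Delta^-)\in\mathbb{R}^{E}_{\ge0}\times\mathbb{R}^{E}_{\ge0}$ with $\sum_{e\in E_{\mathrm{in}}(u)}\Delta^-_e=\sum_{e\in E_{\mathrm{out}}(u)}\Delta^+_e$ for all $u\in V$, $\Delta^-\le w+\Delta^+$ entrywise, and all components at most $\varepsilon$. For weights $v\in\mathbb{R}^E_{\ge0}$, $\mathrm{OPT}(v)=\min_{H\in\mathcal H}\sum_{e\in H}v_e$ is the ordinary TSP value, and $\mathrm{OPT}_{\mathrm{RTSP}}(w,\mathcal D(\varepsilon))=\min_{H\in\mathcal H}\max_{(\Delta^+,\Delta^-)\in\mathcal D(\varepsilon)}\sum_{e\in H}(w_e+\Delta^+_e-\Delta^-_e)$. *)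

theory Defs
  imports Complex_Main "HOL-Library.FuncSet" "Graph_Theory.Graph_Theory"
begin

text \<open>
  The predicate \<^const>\<open>pre_digraph.cycle\<close> requires a nonempty closed walk whose vertices are
  distinct apart from the common start and end vertex; a directed 2-cycle is allowed.
\<close>

definition hamiltonian_cycles :: "('a, 'b) pre_digraph \<Rightarrow> 'b set set" where
  "hamiltonian_cycles G =
     {set p | u p. pre_digraph.cycle G p \<and> pre_digraph.awalk G u p u \<and>
                   set (pre_digraph.awalk_verts G u p) = verts G}"

text \<open>
  Digraphs with fewer than two vertices and no loops have no Hamiltonian cycle, and then the minima
  in \<open>OPT\<close> and \<open>OPT_RTSP\<close> are the unspecified value of \<^const>\<open>Min\<close> at the empty set.
\<close>

definition OPT :: "('a, 'b) pre_digraph \<Rightarrow> ('b \<Rightarrow> real) \<Rightarrow> real" where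
  "OPT G v = Min ((\<lambda>H. \<Sum>e\<in>H. v e) ` hamiltonian_cycles G)"

text \<open>
  The inner maximum ranges over an infinite set, so it is written with \<open>Greatest\<close> (the element
  of a set of reals that is an upper bound of it) instead of \<^const>\<open>Max\<close>, which is only
  meaningful for finite sets. For a nonempty compact uncertainty set the maximum exists.
\<close>

definition OPT_RTSP ::
  "('a, 'b) pre_digraph \<Rightarrow> ('b \<Rightarrow> real) \<Rightarrow> (('b \<Rightarrow> real) \<times> ('b \<Rightarrow> real)) set \<Rightarrow> real" where
  "OPT_RTSP G w D =
     Min ((\<lambda>H. GREATEST r. r \<in> (\<lambda>(dp, dm). \<Sum>e\<in>H. w e + dp e - dm e) ` D)
          ` hamiltonian_cycles G)"

text \<open>
  In a pair \<open>(dp, dm)\<close>, \<open>dp\<close> is \<open>\<Delta>\<^sup>+\<close> and \<open>dm\<close> is \<open>\<Delta>\<^sup>-\<close>. Vectors indexed by the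
  edges are functions that are \<^const>\<open>undefined\<close> outside \<open>arcs G\<close>.
\<close>

definition D_L_inf ::
  "('a, 'b) pre_digraph \<Rightarrow> ('b \<Rightarrow> real) \<Rightarrow> real \<Rightarrow> (('b \<Rightarrow> real) \<times> ('b \<Rightarrow> real)) set" where
  "D_L_inf G w \<epsilon> =
     {(dp, dm).
        dp \<in> arcs G \<rightarrow>\<^sub>E {0..} \<and> dm \<in> arcs G \<rightarrow>\<^sub>E {0..} \<and>
        (\<forall>u\<in>verts G. (\<Sum>e\<in>in_arcs G u. dm e) = (\<Sum>e\<in>out_arcs G u. dp e)) \<and>
        (\<forall>e\<in>arcs G. dm e \<le> w e + dp e) \<and>
        (\<forall>e\<in>arcs G. dp e \<le> \<epsilon> \<and> dm e \<le> \<epsilon>)}"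

definition worst_case_weight ::
  "('a, 'b) pre_digraph \<Rightarrow> ('b \<Rightarrow> real) \<Rightarrow> real \<Rightarrow> 'b \<Rightarrow> real" where
  "worst_case_weight G w \<epsilon> e =
     w e + min \<epsilon> (\<Sum>e'\<in>in_arcs G (head G e) - {e}. min \<epsilon> (w e'))"

end

theory Submission
  imports Defs "HOL-Analysis.Function_Topology"
begin

text \<open>
  All three bounds hold for each Hamiltonian cycle \<open>H\<close> separately and pass to the minimum over \<open>H\<close>.
  The only property of \<open>H\<close> they rest on is that it has exactly one arc into and one arc out of
  each vertex (\<open>hamiltonian_cycle_bij\<close>), so the balance constraint at a vertex \<open>u\<close> says how much
  decrease on arcs into \<open>u\<close> has to pay for an increase on the arc of \<open>H\<close> leaving \<open>u\<close>.

  The adversary's maximum is attained because the uncertainty set is compact, so bounds on it can be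
  read off from feasible points. For the lower bound (\<open>shift_below_robust_cost\<close>) the adversary
  takes weight, at each \<open>u\<close>, only from arcs into \<open>u\<close> outside \<open>H\<close>, at most \<open>min \<epsilon> (w e)\<close> from each
  and at most \<open>\<epsilon>\<close> altogether, and puts it on the arc of \<open>H\<close> leaving \<open>u\<close>. The worst-case weights
  book the same surcharge on the arc of \<open>H\<close> entering \<open>u\<close>; summed over \<open>H\<close>, both count each
  vertex once.

  For the upper bounds, \<open>H\<close> has as many arcs as there are vertices and each gains at most \<open>\<epsilon>\<close>
  (\<open>robust_cost_le_box\<close>). Alternatively (\<open>robust_cost_le_supply\<close>), total increase equals total
  decrease, so the net gain on \<open>H\<close> is the net loss on the arcs outside \<open>H\<close>, where each arc loses
  at most \<open>c e = min \<epsilon> (w e)\<close>. That total is \<open>C\<close> minus the sum of \<open>c\<close> over \<open>H\<close>.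
\<close>

definition robust_cost ::
  "('b \<Rightarrow> real) \<Rightarrow> (('b \<Rightarrow> real) \<times> ('b \<Rightarrow> real)) set \<Rightarrow> 'b set \<Rightarrow> real" where
  "robust_cost w D H = (GREATEST r. r \<in> (\<lambda>(dp, dm). \<Sum>e\<in>H. w e + dp e - dm e) ` D)"

lemma OPT_RTSP_eq: "OPT_RTSP G w D = Min (robust_cost w D ` hamiltonian_cycles G)"
  by (simp add: OPT_RTSP_def robust_cost_def)

text \<open>
  The summand \<open>k\<close> has to be nonnegative because of \<open>X = {}\<close>: a graph on at most one vertex has no
  Hamiltonian cycle, and then both minima are the same unspecified number.
\<close>
lemma Min_image_le_add:
  fixes f g :: "'c \<Rightarrow> real"
  assumes "finite X" "0 \<le> k" and le: "\<And>x. x \<in> X \<Longrightarrow> f x \<le> k + g x"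
  shows "Min (f ` X) \<le> k + Min (g ` X)"
proof (cases "X = {}")
  case True
  then show ?thesis using assms(2) by simp
next
  case False
  then have "Min (g ` X) \<in> g ` X" using assms(1) by (intro Min_in) auto
  then obtain x where x: "x \<in> X" "g x = Min (g ` X)" by auto
  have "Min (f ` X) \<le> f x" using x assms(1) by simp
  also have "\<dots> \<le> k + Min (g ` X)" using le[OF x(1)] x(2) by simp
  finally show ?thesis .
qed

text \<open>
  Listing the vertices of the closed walk by heads shows that no head repeats. The tails cover all
  vertices too, so they are distinct by counting.
\<close>
lemma (in fin_digraph) hamiltonian_cycle_bij:
  assumes "H \<in> hamiltonian_cycles G"
  shows "H \<subseteq> arcs G" "bij_betw (head G) H (verts G)" "bij_betw (tail G) H (verts G)"
proof -
  obtain u p where H: "H = set p" and cyc: "cycle p" and walk: "awalk u p u"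
    and all: "set (awalk_verts u p) = verts G"
    using assms unfolding hamiltonian_cycles_def by auto
  obtain v where v: "awalk v p v" "distinct (tl (awalk_verts v p))" and ne: "p \<noteq> []"
    using cyc by (auto simp: cycle_def)
  show sub: "H \<subseteq> arcs G" using walk H by (auto simp: awalk_def)
  have cas: "cas u p u" using walk by (simp add: awalk_def)
  have vs: "awalk_verts u p = tail G (hd p) # map (head G) p"
    using awalk_verts_conv'[OF cas] ne by simp
  have ts: "awalk_verts u p = map (tail G) p @ [head G (last p)]"
    using awalk_verts_conv ne by simp
  have "tail G (hd p) = u" using cas cas_simp ne by blast
  moreover have "head G (last p) = u" using walk ts by (metis awlast_of_awalk last_snoc NOMATCH_def)
  ultimately have close: "tail G (hd p) = head G (last p)" by simp
  have hd_last: "hd p \<in> set p" "last p \<in> set p" using ne by auto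
  have heads: "head G ` H = verts G"
    using all vs close hd_last H by auto
  have tails: "tail G ` H = verts G"
    using all ts close[symmetric] hd_last H by auto
  have "distinct (map (head G) p)"
    using v(2) vs awalk_verts_ne_eq[OF ne, of u v] by simp
  then have inj: "inj_on (head G) H" using H by (simp add: distinct_map)
  then show "bij_betw (head G) H (verts G)" using heads by (simp add: bij_betw_def)
  have "card (tail G ` H) = card H" using card_image[OF inj] heads tails by simp
  then have "inj_on (tail G) H" using H by (intro eq_card_imp_inj_on) auto
  then show "bij_betw (tail G) H (verts G)" using tails by (simp add: bij_betw_def)
qed

lemma (in fin_digraph) finite_hamiltonian_cycles: "finite (hamiltonian_cycles G)"
  by (rule finite_subset[of _ "Pow (arcs G)"]) (auto dest: hamiltonian_cycle_bij(1))

lemma continuous_on_components: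
  shows "continuous_on S (\<lambda>d :: ('b \<Rightarrow> real) \<times> ('b \<Rightarrow> real). fst d e)"
    and "continuous_on S (\<lambda>d :: ('b \<Rightarrow> real) \<times> ('b \<Rightarrow> real). snd d e)"
  by (rule continuous_on_product_then_coordinatewise, intro continuous_intros)+

text \<open>
  Since vectors are functions fixed to \<^const>\<open>undefined\<close> off the arcs, the box \<open>[0, \<epsilon>]\<close> to the power
  \<open>arcs G\<close> is a product of compact sets over the whole type, with singleton factors off the arcs.
  Tychonoff makes it compact, and the remaining constraints are closed conditions on coordinates.
\<close>
lemma (in fin_digraph) compact_D_L_inf: "compact (D_L_inf G w \<epsilon>)"
proof -
  define B :: "('b \<Rightarrow> real) set"
    where "B = PiE UNIV (\<lambda>e. if e \<in> arcs G then {0..\<epsilon>} else {undefined})"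
  have "compactin (product_topology (\<lambda>_. euclidean) UNIV) B"
    unfolding B_def compactin_PiE by simp
  then have "compact B" by (simp add: euclidean_product_topology)
  then have BB: "compact (B \<times> B)" by (rule compact_Times[OF _ \<open>compact B\<close>])
  define F1 where "F1 = (\<Inter>u\<in>verts G. {d :: ('b \<Rightarrow> real) \<times> ('b \<Rightarrow> real).
      (\<Sum>e\<in>in_arcs G u. snd d e) = (\<Sum>e\<in>out_arcs G u. fst d e)})"
  define F2 where "F2 = (\<Inter>e\<in>arcs G. {d :: ('b \<Rightarrow> real) \<times> ('b \<Rightarrow> real).
      snd d e \<le> w e + fst d e})"
  have "closed F1" unfolding F1_def
    by (intro closed_INT ballI closed_Collect_eq continuous_on_sum continuous_on_components)
  moreover have "closed F2" unfolding F2_def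
    by (intro closed_INT ballI closed_Collect_le continuous_on_add continuous_on_const continuous_on_components)
  ultimately have "compact ((B \<times> B) \<inter> (F1 \<inter> F2))"
    using BB by (intro compact_Int_closed closed_Int)
  moreover have "x \<in> B \<longleftrightarrow> x \<in> arcs G \<rightarrow>\<^sub>E {0..} \<and> (\<forall>e\<in>arcs G. x e \<le> \<epsilon>)" for x
    by (auto simp: B_def PiE_iff extensional_def split: if_splits)
  then have "D_L_inf G w \<epsilon> = (B \<times> B) \<inter> (F1 \<inter> F2)"
    by (auto simp: D_L_inf_def F1_def F2_def)
  ultimately show ?thesis by simp
qed

lemma (in fin_digraph)
  assumes "D_L_inf G w \<epsilon> \<noteq> {}"
  shows robust_cost_attained: "\<exists>dp dm. (dp, dm) \<in> D_L_inf G w \<epsilon> \<and>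
      robust_cost w (D_L_inf G w \<epsilon>) H = (\<Sum>e\<in>H. w e + dp e - dm e)"
    and robust_cost_upper: "(dp', dm') \<in> D_L_inf G w \<epsilon> \<Longrightarrow>
      (\<Sum>e\<in>H. w e + dp' e - dm' e) \<le> robust_cost w (D_L_inf G w \<epsilon>) H"
proof -
  define cost where "cost = (\<lambda>d :: ('b \<Rightarrow> real) \<times> ('b \<Rightarrow> real). \<Sum>e\<in>H. w e + fst d e - snd d e)"
  have "continuous_on UNIV cost" unfolding cost_def
    by (intro continuous_on_sum continuous_on_add continuous_on_diff continuous_on_const continuous_on_components)
  then have "continuous_on (D_L_inf G w \<epsilon>) cost" by (rule continuous_on_subset) simp
  from continuous_attains_sup[OF compact_D_L_inf assms this] obtain d where
    d: "d \<in> D_L_inf G w \<epsilon>" and max: "\<And>d'. d' \<in> D_L_inf G w \<epsilon> \<Longrightarrow> cost d' \<le> cost d"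
    by blast
  have "robust_cost w (D_L_inf G w \<epsilon>) H = (GREATEST r. r \<in> cost ` D_L_inf G w \<epsilon>)"
    by (simp add: robust_cost_def cost_def case_prod_unfold)
  also have "\<dots> = cost d" by (rule Greatest_equality) (use d max in auto)
  finally have eq: "robust_cost w (D_L_inf G w \<epsilon>) H = cost d" .
  show "\<exists>dp dm. (dp, dm) \<in> D_L_inf G w \<epsilon> \<and>
      robust_cost w (D_L_inf G w \<epsilon>) H = (\<Sum>e\<in>H. w e + dp e - dm e)"
    using d eq by (intro exI[of _ "fst d"] exI[of _ "snd d"]) (simp add: cost_def)
  show "(\<Sum>e\<in>H. w e + dp' e - dm' e) \<le> robust_cost w (D_L_inf G w \<epsilon>) H"
    if "(dp', dm') \<in> D_L_inf G w \<epsilon>"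
    using max[OF that] eq by (simp add: cost_def)
qed

lemma zero_mem_D_L_inf:
  assumes "\<And>e. e \<in> arcs G \<Longrightarrow> 0 \<le> w e" and "0 \<le> \<epsilon>"
  shows "((\<lambda>e\<in>arcs G. 0), (\<lambda>e\<in>arcs G. 0)) \<in> D_L_inf G w \<epsilon>"
  using assms by (auto simp: D_L_inf_def in_arcs_def out_arcs_def intro!: sum.cong)

text \<open>
  At \<open>u\<close> the arcs outside \<open>H\<close> can supply \<open>S u\<close>, of which the outgoing arc of \<open>H\<close> can absorb
  \<open>m u = min \<epsilon> (S u)\<close>. Scaling every contribution by \<open>m u / S u\<close> keeps each arc within its own
  bounds and makes inflow and outflow agree.
\<close>
lemma (in fin_digraph) shift_below_robust_cost:
  assumes H: "H \<in> hamiltonian_cycles G"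
    and w: "\<And>e. e \<in> arcs G \<Longrightarrow> 0 \<le> w e" and "0 \<le> \<epsilon>"
  shows "(\<Sum>e\<in>H. worst_case_weight G w \<epsilon> e) \<le> robust_cost w (D_L_inf G w \<epsilon>) H"
proof -
  note Hb = hamiltonian_cycle_bij[OF H]
  have inj_h: "inj_on (head G) H" and inj_t: "inj_on (tail G) H"
    using Hb by (auto simp: bij_betw_def)
  define S where "S u = (\<Sum>e\<in>in_arcs G u - H. min \<epsilon> (w e))" for u
  define m where "m u = min \<epsilon> (S u)" for u
  define dp where "dp = (\<lambda>e\<in>arcs G. if e \<in> H then m (tail G e) else 0)"
  define dm where "dm = (\<lambda>e\<in>arcs G. if e \<in> H then 0 else
    min \<epsilon> (w e) * (m (head G e) / S (head G e)))"
  have S0: "0 \<le> S u" for u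
    unfolding S_def by (intro sum_nonneg) (use w assms(3) in auto)
  have m0: "0 \<le> m u" "m u \<le> \<epsilon>" "m u \<le> S u" for u using S0[of u] assms(3) by (auto simp: m_def)
  have ratio: "0 \<le> m u / S u" "m u / S u \<le> 1" for u
    using m0[of u] S0[of u] by (auto simp: divide_le_eq_1)
  have dm_bounds: "0 \<le> dm e" "dm e \<le> min \<epsilon> (w e)" if "e \<in> arcs G" for e
  proof -
    have c0: "0 \<le> min \<epsilon> (w e)" using w[OF that] assms(3) by simp
    show "0 \<le> dm e" using that mult_nonneg_nonneg[OF c0 ratio(1)] by (simp add: dm_def)
    show "dm e \<le> min \<epsilon> (w e)"
      using that mult_left_le[OF ratio(2) c0] c0 by (simp add: dm_def)
  qed
  have dp_bounds: "0 \<le> dp e" "dp e \<le> \<epsilon>" if "e \<in> arcs G" for e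
    using that m0 assms(3) by (auto simp: dp_def)
  \<comment> \<open>If \<open>S u = 0\<close>, then also \<open>m u = 0\<close>, so the convention \<open>x / 0 = 0\<close> gives the right flow.\<close>
  have balance: "(\<Sum>e\<in>in_arcs G u. dm e) = (\<Sum>e\<in>out_arcs G u. dp e)" if u: "u \<in> verts G" for u
  proof -
    have "(\<Sum>e\<in>in_arcs G u. dm e) = (\<Sum>e\<in>in_arcs G u - H. min \<epsilon> (w e) * (m u / S u))"
      by (rule sum.mono_neutral_cong_right) (auto simp: dm_def)
    also have "\<dots> = S u * (m u / S u)" unfolding S_def[of u] by (rule sum_distrib_right[symmetric])
    also have "\<dots> = m u" using m0[of u] by (cases "S u = 0") auto
    finally have inflow: "(\<Sum>e\<in>in_arcs G u. dm e) = m u" .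
    obtain e where e: "e \<in> H" "tail G e = u"
      using u bij_betw_imp_surj_on[OF Hb(3)] by (metis imageE)
    have "(\<Sum>e\<in>out_arcs G u. dp e) = (\<Sum>e\<in>{e}. m u)"
      by (rule sum.mono_neutral_cong_right)
        (use e Hb(1) inj_t in \<open>auto simp: dp_def dest: inj_onD\<close>)
    then show ?thesis using inflow by simp
  qed
  have mem: "(dp, dm) \<in> D_L_inf G w \<epsilon>"
  proof -
    have "dm e \<le> w e + dp e" "dm e \<le> \<epsilon>" if "e \<in> arcs G" for e
      using dm_bounds(2)[OF that] dp_bounds(1)[OF that] by auto
    moreover have "dp \<in> arcs G \<rightarrow>\<^sub>E {0..}" "dm \<in> arcs G \<rightarrow>\<^sub>E {0..}"
      using dm_bounds(1) dp_bounds(1) by (auto simp: PiE_iff) (auto simp: dp_def dm_def)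
    ultimately show ?thesis using dp_bounds(2) balance by (auto simp: D_L_inf_def)
  qed
  \<comment> \<open>Removing \<open>e\<close> from the arcs into its head removes all arcs of \<open>H\<close> there, so the surcharge
    is a function of the vertex alone.\<close>
  have wc: "worst_case_weight G w \<epsilon> e = w e + m (head G e)" if "e \<in> H" for e
  proof -
    have "in_arcs G (head G e) - {e} = in_arcs G (head G e) - H"
      using that inj_h by (auto dest: inj_onD)
    then show ?thesis by (simp add: worst_case_weight_def m_def S_def)
  qed
  have "(\<Sum>e\<in>H. m (head G e)) = (\<Sum>e\<in>H. m (tail G e))"
    using sum.reindex_bij_betw[OF Hb(2), of m] sum.reindex_bij_betw[OF Hb(3), of m] by simp
  then have "(\<Sum>e\<in>H. worst_case_weight G w \<epsilon> e) = (\<Sum>e\<in>H. w e + m (tail G e))"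
    by (simp add: wc sum.distrib)
  also have "\<dots> = (\<Sum>e\<in>H. w e + dp e - dm e)"
    by (rule sum.cong) (use Hb(1) in \<open>auto simp: dp_def dm_def\<close>)
  also have "\<dots> \<le> robust_cost w (D_L_inf G w \<epsilon>) H"
    using mem by (intro robust_cost_upper) auto
  finally show ?thesis .
qed

lemma (in fin_digraph) robust_cost_le_box:
  assumes H: "H \<in> hamiltonian_cycles G"
    and ne: "D_L_inf G w \<epsilon> \<noteq> {}"
  shows "robust_cost w (D_L_inf G w \<epsilon>) H \<le> real (card (verts G)) * \<epsilon> + (\<Sum>e\<in>H. w e)"
proof -
  obtain dp dm where mem: "(dp, dm) \<in> D_L_inf G w \<epsilon>"
    and eq: "robust_cost w (D_L_inf G w \<epsilon>) H = (\<Sum>e\<in>H. w e + dp e - dm e)"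
    using robust_cost_attained[OF ne] by blast
  note Hb = hamiltonian_cycle_bij[OF H]
  have "(\<Sum>e\<in>H. w e + dp e - dm e) \<le> (\<Sum>e\<in>H. w e + \<epsilon>)"
  proof (rule sum_mono)
    fix e assume "e \<in> H"
    then have "dp e \<le> \<epsilon>" "0 \<le> dm e" using mem Hb(1) by (auto simp: D_L_inf_def PiE_iff)
    then show "w e + dp e - dm e \<le> w e + \<epsilon>" by simp
  qed
  also have "\<dots> = real (card (verts G)) * \<epsilon> + (\<Sum>e\<in>H. w e)"
    using bij_betw_same_card[OF Hb(2)] by (simp add: sum.distrib)
  finally show ?thesis using eq by simp
qed

lemma (in fin_digraph) robust_cost_le_supply:
  assumes H: "H \<in> hamiltonian_cycles G"
    and ne: "D_L_inf G w \<epsilon> \<noteq> {}"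
    and c: "\<And>e. e \<in> arcs G \<Longrightarrow> c e = min \<epsilon> (w e)"
  shows "robust_cost w (D_L_inf G w \<epsilon>) H \<le> (\<Sum>e\<in>arcs G. c e) + (\<Sum>e\<in>H. w e - c e)"
proof -
  obtain dp dm where mem: "(dp, dm) \<in> D_L_inf G w \<epsilon>"
    and eq: "robust_cost w (D_L_inf G w \<epsilon>) H = (\<Sum>e\<in>H. w e + dp e - dm e)"
    using robust_cost_attained[OF ne] by blast
  have sub: "H \<subseteq> arcs G" by (rule hamiltonian_cycle_bij(1)[OF H])
  have split: "(\<Sum>e\<in>arcs G. f e) = (\<Sum>e\<in>arcs G - H. f e) + (\<Sum>e\<in>H. f e)" for f :: "'b \<Rightarrow> real"
    using sum.subset_diff[OF sub finite_arcs] .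
  have total_in: "(\<Sum>u\<in>verts G. \<Sum>e\<in>in_arcs G u. f e) = (\<Sum>e\<in>arcs G. f e)" for f :: "'b \<Rightarrow> real"
    using sum.group[of "arcs G" "verts G" "head G" f] by (simp add: in_arcs_def image_subset_iff)
  have total_out: "(\<Sum>u\<in>verts G. \<Sum>e\<in>out_arcs G u. f e) = (\<Sum>e\<in>arcs G. f e)" for f :: "'b \<Rightarrow> real"
    using sum.group[of "arcs G" "verts G" "tail G" f] by (simp add: out_arcs_def image_subset_iff)
  \<comment> \<open>Summing the balance constraints over all vertices.\<close>
  have "(\<Sum>e\<in>arcs G. dm e) = (\<Sum>u\<in>verts G. \<Sum>e\<in>in_arcs G u. dm e)" by (simp add: total_in)
  also have "\<dots> = (\<Sum>u\<in>verts G. \<Sum>e\<in>out_arcs G u. dp e)"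
    by (rule sum.cong) (use mem in \<open>auto simp: D_L_inf_def\<close>)
  also have "\<dots> = (\<Sum>e\<in>arcs G. dp e)" by (simp add: total_out)
  finally have total: "(\<Sum>e\<in>arcs G. dm e) = (\<Sum>e\<in>arcs G. dp e)" .
  \<comment> \<open>An arc loses at most \<open>w e\<close> net of its own increase, and at most \<open>\<epsilon>\<close> even without it.\<close>
  have "(\<Sum>e\<in>arcs G - H. dm e - dp e) \<le> (\<Sum>e\<in>arcs G - H. c e)"
  proof (rule sum_mono)
    fix e assume "e \<in> arcs G - H"
    then have "dm e \<le> w e + dp e" "dm e \<le> \<epsilon>" "0 \<le> dp e" "c e = min \<epsilon> (w e)"
      using mem c by (auto simp: D_L_inf_def PiE_iff)
    then show "dm e - dp e \<le> c e" by simp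
  qed
  then show ?thesis
    using total eq split[of dm] split[of dp] split[of c] by (simp add: sum.distrib sum_subtractf)
qed

theorem mainTheorem9:
  fixes G :: "('a, 'b) pre_digraph" and n :: nat
    and w c :: "'b \<Rightarrow> real" and \<epsilon> C :: real
  assumes "complete_digraph n G"
    and "\<And>e. e \<in> arcs G \<Longrightarrow> 0 \<le> w e"
    and "0 \<le> \<epsilon>"
    and "\<And>e. e \<in> arcs G \<Longrightarrow> c e = min \<epsilon> (w e)"
    and "C = (\<Sum>e\<in>arcs G. c e)"
  shows "OPT G (worst_case_weight G w \<epsilon>) \<le> OPT_RTSP G w (D_L_inf G w \<epsilon>)
       \<and> OPT_RTSP G w (D_L_inf G w \<epsilon>)
           \<le> min (OPT G w + real n * \<epsilon>) (C + OPT G (\<lambda>e. w e - c e))"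
proof -
  have "graph G" and n: "card (verts G) = n" using assms(1) by (auto simp: complete_digraph_def)
  then interpret graph G by simp
  let ?D = "D_L_inf G w \<epsilon>"
  have ne: "?D \<noteq> {}" using zero_mem_D_L_inf[of G w \<epsilon>] assms(2,3) by blast
  have "0 \<le> C" unfolding assms(5) using assms(2-4) by (intro sum_nonneg) auto
  note Min_le = Min_image_le_add[OF finite_hamiltonian_cycles]
  have "OPT G (worst_case_weight G w \<epsilon>) \<le> 0 + OPT_RTSP G w ?D"
    unfolding OPT_RTSP_eq OPT_def
    by (rule Min_le) (use shift_below_robust_cost assms(2,3) in auto)
  moreover have "OPT_RTSP G w ?D \<le> real n * \<epsilon> + OPT G w"
    unfolding OPT_RTSP_eq OPT_def
    by (rule Min_le) (use robust_cost_le_box[OF _ ne] n assms(3) in auto)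
  moreover have "OPT_RTSP G w ?D \<le> C + OPT G (\<lambda>e. w e - c e)"
    unfolding OPT_RTSP_eq OPT_def assms(5)
    by (rule Min_le) (use robust_cost_le_supply[OF _ ne] assms(4,5) \<open>0 \<le> C\<close> in auto)
  ultimately show ?thesis by simp
qed

end
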